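(* For every $F\in\mathbb{N}$ and $L\in[1,\infty)$ there are real constants $E,E'''>0$ such that the following holds. Let $R$ be a commutative ring, let $(X,w)$ be a properly weighted $R$-oriented $d$-poset ($d\ge1$) such that $L(X)\le L$ and every $1$-face of $X$ contains at most $F$ $0$-faces. Let $\mathcal{F}$ be an $R$-sheaf on $X$ and let $\varepsilon,\alpha,\beta\in[0,\infty)$. Suppose that (1) $\mathrm{cbe}_{-1}(X_v,w_v,\mathcal{F}_v)\ge\varepsilon$ for every $v\in X(0)$, and (2) $\mathrm{Gr}(X,w)$ is an $(\alpha,\beta)$-skeleton expander. Then $\mathrm{ccd}_0(X,w,\mathcal{F})\ge\frac{E'''(E\varepsilon-\alpha)}{\beta}$ (where the quotient is understood for $\beta>0$). One may take $E=L^{-8}$ and $E'''=L^{-3}$; in particular $E=E'''=1$ when $X$ is lower-regular.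
   Context: **Posets.** All posets are finite; $x\lhd y$ means $x<y$ with no element strictly between. A graded poset is a poset $X$ with $\dim:X\to\mathbb{Z}$ such that $x\le y$ implies $\dim x\le\dim y$ and $x\lhd y$ implies $\dim y=\dim x+1$. Put $X(i)=\{x\in X:\dim x=i\}$ ($i$-faces), $x(i)=\{y\in X(i):y\le x\}$, and $A_x=\{a\in A:a\ge x\}$ for $A\subseteq X$. A $d$-poset ($d\ge 0$) is a nonempty graded poset in which every face is $\le$ some $d$-face and which has a face $\emptyset_X$ with $\dim\emptyset_X=-1$ and $\emptyset_X\le x$ for all $x$. **Lower irregularity.** For $i\le j\le k$, $F^{\max}_{i,j,k}$ (resp. $F^{\min}_{i,j,k}$) is the maximal (resp. minimal) number of $y\in X(j)$ with $x\le y\le z$, over all $x\in X(i)$, $z\in X(k)$ with $x\le z$. $L(X)=\max_{-1\le i\le j\le k\le d}F^{\max}_{i,j,k}/F^{\min}_{i,j,k}$; $X$ is lower-regular if $L(X)=1$. **Weights and links.** A proper weight function on a $d$-poset $X$ is $w:X\to\mathbb{R}_+$ (positive reals) with $\sum_{y\in X(d)}w(y)=1$ and $w(x)=\sum_{y\in X(d),\,y\ge x}w(y)/|y(i)|$ for all $x\in X(i)$ and all $i$. For $A\subseteq X$, $w(A)=\sum_{a\in A}w(a)$. For $z\in X$ the link is $X_z=\{x\in X:x\ge z\}$ with $\dim_{X_z}x=\dim x-\dim z-1$, given the proper weight function $w_z(x)=\frac{1}{w(X(d)_z)}\sum_{y\in X(d)_x}\frac{w(y)}{\#\{x'\in X(\dim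 x):z\le x'\le y\}}$. **Orientation, sheaves, cohomology.** An $R$-orientation on $X$ assigns $[y:x]\in R^\times$ to each $x\lhd y$ so that $\sum_{y:x<y<z}[z:y][y:x]=0$ whenever $x\le z$ and $\dim z=\dim x+2$; links carry the restricted orientation. An $R$-sheaf $\mathcal{F}$ on $X$ consists of $R$-modules $\mathcal{F}(x)$ and $R$-linear maps $\mathrm{res}_{y\leftarrow x}:\mathcal{F}(x)\to\mathcal{F}(y)$ ($x<y$) with $\mathrm{res}_{z\leftarrow y}\circ\mathrm{res}_{y\leftarrow x}=\mathrm{res}_{z\leftarrow x}$ for $x<y<z$; $\mathcal{F}_z$ is its restriction to $X_z$. $C^i=C^i(X,\mathcal{F})=\prod_{x\in X(i)}\mathcal{F}(x)$; $(d_if)(y)=\sum_{x\in y(i)}[y:x]\,\mathrm{res}_{y\leftarrow x}f(x)$ for $f\in C^i$, $y\in X(i+1)$; $Z^i=\ker d_i$, $B^i=\mathrm{im}\,d_{i-1}$. **Expansion.** $\|f\|_w=w(\{x:f(x)\ne0\})$, $\mathrm{dist}_w(f,g)=\|f-g\|_w$. $\mathrm{cbe}_i(X,w,\mathcal{F})$ is the supremum of the $\mu\ge 0$ with $\|d_if\|_w\ge\mu\,\mathrm{dist}_w(f,B^i)$ for all $f\in C^i$; $\mathrm{ccd}_i(X,w,\mathcal{F})=\inf\{\|f\|_w:f\in Z^i\setminus B^i\}$. $\mathrm{Gr}(X,w)$ is the weighted hypergraph with vertices $X(0)$, hyperedges $X(1)$; it is an $(\alpha,\beta)$-skeleton expander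 if for all $A\subseteq X(0)$ the total weight of the $e\in X(1)$ having at least two distinct vertices in $A$ is at most $\alpha w(A)+\beta w(A)^2$. *)

theory Defs
  imports "HOL-Library.Extended_Real" "HOL-Algebra.Module"
begin

section \<open>Graded posets\<close>

record 'a gposet =
  faces :: "'a set"
  le_rel :: "'a rel"
  fdim :: "'a \<Rightarrow> int"

abbreviation face_le :: "'a \<Rightarrow> 'a gposet \<Rightarrow> 'a \<Rightarrow> bool"  (\<open>(_/ \<preceq>\<^bsub>_\<^esub> _)\<close> [51, 0, 51] 50)
  where "x \<preceq>\<^bsub>X\<^esub> y \<equiv> (x, y) \<in> le_rel X"

abbreviation face_less :: "'a \<Rightarrow> 'a gposet \<Rightarrow> 'a \<Rightarrow> bool"  (\<open>(_/ \<prec>\<^bsub>_\<^esub> _)\<close> [51, 0, 51] 50)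
  where "x \<prec>\<^bsub>X\<^esub> y \<equiv> x \<preceq>\<^bsub>X\<^esub> y \<and> x \<noteq> y"

definition covered_by :: "'a gposet \<Rightarrow> 'a \<Rightarrow> 'a \<Rightarrow> bool"
  where "covered_by X x y \<longleftrightarrow> x \<prec>\<^bsub>X\<^esub> y \<and> \<not> (\<exists>u\<in>faces X. x \<prec>\<^bsub>X\<^esub> u \<and> u \<prec>\<^bsub>X\<^esub> y)"

definition graded_poset :: "'a gposet \<Rightarrow> bool"
  where "graded_poset X \<longleftrightarrow>
    finite (faces X) \<and> partial_order_on (faces X) (le_rel X) \<and>
    (\<forall>x\<in>faces X. \<forall>y\<in>faces X. x \<preceq>\<^bsub>X\<^esub> y \<longrightarrow> fdim X x \<le> fdim X y) \<and>
    (\<forall>x\<in>faces X. \<forall>y\<in>faces X. covered_by X x y \<longrightarrow> fdim X y = fdim X x + 1)"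

text \<open>\<open>X(i)\<close>, \<open>y(i)\<close> and \<open>A\<^sub>x\<close>, in this order.\<close>

definition ifaces :: "'a gposet \<Rightarrow> int \<Rightarrow> 'a set"
  where "ifaces X i = {x \<in> faces X. fdim X x = i}"

definition ifaces_of :: "'a gposet \<Rightarrow> 'a \<Rightarrow> int \<Rightarrow> 'a set"
  where "ifaces_of X y i = {x \<in> ifaces X i. x \<preceq>\<^bsub>X\<^esub> y}"

definition above_face :: "'a gposet \<Rightarrow> 'a set \<Rightarrow> 'a \<Rightarrow> 'a set"
  where "above_face X A x = {a \<in> A. x \<preceq>\<^bsub>X\<^esub> a}"

definition d_poset :: "nat \<Rightarrow> 'a gposet \<Rightarrow> bool"
  where "d_poset d X \<longleftrightarrow>
    graded_poset X \<and> faces X \<noteq> {} \<and>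
    (\<forall>x\<in>faces X. \<exists>y\<in>ifaces X (int d). x \<preceq>\<^bsub>X\<^esub> y) \<and>
    (\<exists>e\<in>faces X. fdim X e = -1 \<and> (\<forall>x\<in>faces X. e \<preceq>\<^bsub>X\<^esub> x))"


section \<open>Lower irregularity\<close>

definition interval_counts :: "'a gposet \<Rightarrow> int \<Rightarrow> int \<Rightarrow> int \<Rightarrow> nat set"
  where "interval_counts X i j k =
    {card {y \<in> ifaces X j. x \<preceq>\<^bsub>X\<^esub> y \<and> y \<preceq>\<^bsub>X\<^esub> z} | x z.
      x \<in> ifaces X i \<and> z \<in> ifaces X k \<and> x \<preceq>\<^bsub>X\<^esub> z}"

definition F_max :: "'a gposet \<Rightarrow> int \<Rightarrow> int \<Rightarrow> int \<Rightarrow> nat"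
  where "F_max X i j k = Max (interval_counts X i j k)"

definition F_min :: "'a gposet \<Rightarrow> int \<Rightarrow> int \<Rightarrow> int \<Rightarrow> nat"
  where "F_min X i j k = Min (interval_counts X i j k)"

definition lower_irregularity :: "nat \<Rightarrow> 'a gposet \<Rightarrow> real"
  where "lower_irregularity d X =
    Max {real (F_max X i j k) / real (F_min X i j k) | i j k. -1 \<le> i \<and> i \<le> j \<and> j \<le> k \<and> k \<le> int d}"

definition lower_regular :: "nat \<Rightarrow> 'a gposet \<Rightarrow> bool"
  where "lower_regular d X \<longleftrightarrow> lower_irregularity d X = 1"


section \<open>Weights and links\<close>

definition proper_weight :: "nat \<Rightarrow> 'a gposet \<Rightarrow> ('a \<Rightarrow> real) \<Rightarrow> bool"
  where "proper_weight d X w \<longleftrightarrow>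
    (\<forall>x\<in>faces X. 0 < w x) \<and>
    (\<Sum>y\<in>ifaces X (int d). w y) = 1 \<and>
    (\<forall>i. \<forall>x\<in>ifaces X i.
      w x = (\<Sum>y\<in>above_face X (ifaces X (int d)) x. w y / real (card (ifaces_of X y i))))"

definition link :: "'a gposet \<Rightarrow> 'a \<Rightarrow> 'a gposet"
  where "link X z =
    \<lparr>faces = above_face X (faces X) z,
     le_rel = Restr (le_rel X) (above_face X (faces X) z),
     fdim = (\<lambda>x. fdim X x - fdim X z - 1)\<rparr>"

definition link_weight :: "nat \<Rightarrow> 'a gposet \<Rightarrow> ('a \<Rightarrow> real) \<Rightarrow> 'a \<Rightarrow> 'a \<Rightarrow> real"
  where "link_weight d X w z x =
    (1 / (\<Sum>y\<in>above_face X (ifaces X (int d)) z. w y)) *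
    (\<Sum>y\<in>above_face X (ifaces X (int d)) x.
      w y / real (card {x' \<in> ifaces X (fdim X x). z \<preceq>\<^bsub>X\<^esub> x' \<and> x' \<preceq>\<^bsub>X\<^esub> y}))"


section \<open>Orientations and sheaves\<close>

text \<open>\<open>orn y x\<close> stands for \<open>[y:x]\<close> and \<open>res_map S y x\<close> for the restriction map from the
  module at \<open>x\<close> to the module at \<open>y\<close>. Both are read only at faces \<open>x \<prec> y\<close> of the poset at hand,
  so the same \<open>orn\<close> and \<open>S\<close> also serve as the restricted orientation and sheaf on a link.\<close>

definition orientation ::
  "('r, 'b) ring_scheme \<Rightarrow> 'a gposet \<Rightarrow> ('a \<Rightarrow> 'a \<Rightarrow> 'r) \<Rightarrow> bool"
  where "orientation R X orn \<longleftrightarrow>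
    (\<forall>x\<in>faces X. \<forall>y\<in>faces X. covered_by X x y \<longrightarrow> orn y x \<in> Units R) \<and>
    (\<forall>x\<in>faces X. \<forall>z\<in>faces X. x \<preceq>\<^bsub>X\<^esub> z \<and> fdim X z = fdim X x + 2 \<longrightarrow>
      finsum R (\<lambda>y. orn z y \<otimes>\<^bsub>R\<^esub> orn y x) {y \<in> faces X. x \<prec>\<^bsub>X\<^esub> y \<and> y \<prec>\<^bsub>X\<^esub> z} = \<zero>\<^bsub>R\<^esub>)"

record ('a, 'r, 'm) sheaf_data =
  stalk :: "'a \<Rightarrow> ('r, 'm) module"
  res_map :: "'a \<Rightarrow> 'a \<Rightarrow> 'm \<Rightarrow> 'm"

definition linear_maps ::
  "('r, 'b) ring_scheme \<Rightarrow> ('r, 'm) module \<Rightarrow> ('r, 'n) module \<Rightarrow> ('m \<Rightarrow> 'n) set"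
  where "linear_maps R M N =
    {h \<in> hom (add_monoid M) (add_monoid N).
      \<forall>r\<in>carrier R. \<forall>m\<in>carrier M. h (r \<odot>\<^bsub>M\<^esub> m) = r \<odot>\<^bsub>N\<^esub> h m}"

definition sheaf_on ::
  "('r, 'b) ring_scheme \<Rightarrow> 'a gposet \<Rightarrow> ('a, 'r, 'm) sheaf_data \<Rightarrow> bool"
  where "sheaf_on R X S \<longleftrightarrow>
    (\<forall>x\<in>faces X. Module.module R (stalk S x)) \<and>
    (\<forall>x\<in>faces X. \<forall>y\<in>faces X. x \<prec>\<^bsub>X\<^esub> y \<longrightarrow> res_map S y x \<in> linear_maps R (stalk S x) (stalk S y)) \<and>
    (\<forall>x\<in>faces X. \<forall>y\<in>faces X. \<forall>z\<in>faces X. x \<prec>\<^bsub>X\<^esub> y \<and> y \<prec>\<^bsub>X\<^esub> z \<longrightarrow>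
      (\<forall>m\<in>carrier (stalk S x). res_map S z y (res_map S y x m) = res_map S z x m))"


section \<open>Cochains\<close>

text \<open>There are no faces of dimension \<open>-2\<close>, so the cochains of degree \<open>-2\<close> form the one-point
  product and the only coboundary of degree \<open>-1\<close> is zero (an empty \<^const>\<open>finsum\<close>).\<close>

definition cochains :: "int \<Rightarrow> 'a gposet \<Rightarrow> ('a, 'r, 'm) sheaf_data \<Rightarrow> ('a \<Rightarrow> 'm) set"
  where "cochains i X S = (\<Pi>\<^sub>E x\<in>ifaces X i. carrier (stalk S x))"

definition coboundary ::
  "int \<Rightarrow> 'a gposet \<Rightarrow> ('a \<Rightarrow> 'a \<Rightarrow> 'r) \<Rightarrow> ('a, 'r, 'm) sheaf_data \<Rightarrow> ('a \<Rightarrow> 'm) \<Rightarrow> 'a \<Rightarrow> 'm"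
  where "coboundary i X orn S f =
    (\<lambda>y\<in>ifaces X (i + 1).
      finsum (stalk S y) (\<lambda>x. orn y x \<odot>\<^bsub>stalk S y\<^esub> res_map S y x (f x)) (ifaces_of X y i))"

definition cocycles ::
  "int \<Rightarrow> 'a gposet \<Rightarrow> ('a \<Rightarrow> 'a \<Rightarrow> 'r) \<Rightarrow> ('a, 'r, 'm) sheaf_data \<Rightarrow> ('a \<Rightarrow> 'm) set"
  where "cocycles i X orn S =
    {f \<in> cochains i X S. \<forall>y\<in>ifaces X (i + 1). coboundary i X orn S f y = \<zero>\<^bsub>stalk S y\<^esub>}"

definition coboundaries ::
  "int \<Rightarrow> 'a gposet \<Rightarrow> ('a \<Rightarrow> 'a \<Rightarrow> 'r) \<Rightarrow> ('a, 'r, 'm) sheaf_data \<Rightarrow> ('a \<Rightarrow> 'm) set"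
  where "coboundaries i X orn S = coboundary (i - 1) X orn S ` cochains (i - 1) X S"


section \<open>Expansion\<close>

definition wnorm ::
  "int \<Rightarrow> 'a gposet \<Rightarrow> ('a \<Rightarrow> real) \<Rightarrow> ('a, 'r, 'm) sheaf_data \<Rightarrow> ('a \<Rightarrow> 'm) \<Rightarrow> real"
  where "wnorm i X w S f = (\<Sum>x | x \<in> ifaces X i \<and> f x \<noteq> \<zero>\<^bsub>stalk S x\<^esub>. w x)"

definition wdist ::
  "int \<Rightarrow> 'a gposet \<Rightarrow> ('a \<Rightarrow> real) \<Rightarrow> ('a, 'r, 'm) sheaf_data \<Rightarrow> ('a \<Rightarrow> 'm) \<Rightarrow> ('a \<Rightarrow> 'm) \<Rightarrow> real"
  where "wdist i X w S f g = wnorm i X w S (\<lambda>x\<in>ifaces X i. f x \<ominus>\<^bsub>stalk S x\<^esub> g x)"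

text \<open>The constants \<open>cbe\<close> and \<open>ccd\<close> can be infinite: \<open>cbe\<close> when every cochain is a coboundary,
  \<open>ccd\<close> when every cocycle is one.\<close>

definition cbe ::
  "int \<Rightarrow> 'a gposet \<Rightarrow> ('a \<Rightarrow> real) \<Rightarrow> ('a \<Rightarrow> 'a \<Rightarrow> 'r) \<Rightarrow> ('a, 'r, 'm) sheaf_data \<Rightarrow> ereal"
  where "cbe i X w orn S =
    Sup {ereal \<mu> | \<mu>. 0 \<le> \<mu> \<and>
      (\<forall>f\<in>cochains i X S.
        \<mu> * (INF g\<in>coboundaries i X orn S. wdist i X w S f g)
          \<le> wnorm (i + 1) X w S (coboundary i X orn S f))}"

definition ccd ::
  "int \<Rightarrow> 'a gposet \<Rightarrow> ('a \<Rightarrow> real) \<Rightarrow> ('a \<Rightarrow> 'a \<Rightarrow> 'r) \<Rightarrow> ('a, 'r, 'm) sheaf_data \<Rightarrow> ereal"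
  where "ccd i X w orn S =
    (INF f\<in>cocycles i X orn S - coboundaries i X orn S. ereal (wnorm i X w S f))"

record ('v, 'e) weighted_hypergraph =
  vertices :: "'v set"
  hyperedges :: "'e set"
  ends :: "'e \<Rightarrow> 'v set"
  vertex_weight :: "'v \<Rightarrow> real"
  hyperedge_weight :: "'e \<Rightarrow> real"

definition Gr :: "'a gposet \<Rightarrow> ('a \<Rightarrow> real) \<Rightarrow> ('a, 'a) weighted_hypergraph"
  where "Gr X w =
    \<lparr>vertices = ifaces X 0, hyperedges = ifaces X 1, ends = (\<lambda>e. ifaces_of X e 0),
     vertex_weight = w, hyperedge_weight = w\<rparr>"

definition skeleton_expander :: "('v, 'e) weighted_hypergraph \<Rightarrow> real \<Rightarrow> real \<Rightarrow> bool"
  where "skeleton_expander G \<alpha> \<beta> \<longleftrightarrow>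
    (\<forall>A\<subseteq>vertices G.
      (\<Sum>e | e \<in> hyperedges G \<and> (\<exists>u v. u \<noteq> v \<and> {u, v} \<subseteq> ends G e \<inter> A). hyperedge_weight G e)
        \<le> \<alpha> * (\<Sum>v\<in>A. vertex_weight G v) + \<beta> * (\<Sum>v\<in>A. vertex_weight G v)\<^sup>2)"

end

theory Submission
  imports Defs
begin

text \<open>
  Let \<open>f\<close> be a \<open>0\<close>-cocycle that is not a coboundary, \<open>A\<close> its nonempty support, and \<open>E\<^sub>A\<close> the set of
  \<open>1\<close>-faces with at least two vertices in \<open>A\<close>. For \<open>v \<in> A\<close>, expansion in the link of \<open>v\<close> says that
  the edges \<open>e\<close> at \<open>v\<close> to which \<open>f v\<close> restricts nontrivially have \<open>w\<^sub>v\<close>-weight at least \<open>\<epsilon>\<close>; the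
  cocycle condition at such an \<open>e\<close> forces another vertex of \<open>e\<close> into \<open>A\<close>, so \<open>e \<in> E\<^sub>A\<close>.
  Multiplying by \<open>w v\<close> and summing over \<open>A\<close> gives \<open>\<epsilon> w(A) \<le> L\<^sup>4 w(E\<^sub>A)\<close>, where \<open>L\<^sup>4\<close> accounts for
  comparing the numbers of faces in intervals, and the skeleton expansion of \<open>A\<close> concludes. The
  exponents \<open>8\<close> and \<open>3\<close> in the theorem are therefore not sharp.
\<close>

section \<open>Intervals in graded posets\<close>

locale finite_graded_poset =
  fixes X :: "'a gposet"
  assumes graded: "graded_poset X"
begin

lemma finite_faces [simp, intro]: "finite (faces X)"
  using graded by (simp add: graded_poset_def)

lemma finite_ifaces [simp, intro]: "finite (ifaces X i)"
  by (simp add: ifaces_def)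

lemma face_le_refl: "x \<in> faces X \<Longrightarrow> x \<preceq>\<^bsub>X\<^esub> x"
  using graded by (auto simp: graded_poset_def partial_order_on_def preorder_on_def refl_on_def)

lemma face_le_trans: "x \<preceq>\<^bsub>X\<^esub> y \<Longrightarrow> y \<preceq>\<^bsub>X\<^esub> z \<Longrightarrow> x \<preceq>\<^bsub>X\<^esub> z"
  using graded by (auto simp: graded_poset_def partial_order_on_def preorder_on_def dest: transD)

lemma face_le_antisym: "x \<preceq>\<^bsub>X\<^esub> y \<Longrightarrow> y \<preceq>\<^bsub>X\<^esub> x \<Longrightarrow> x = y"
  using graded by (auto simp: graded_poset_def partial_order_on_def dest: antisymD)

lemma fdim_mono: "x \<in> faces X \<Longrightarrow> y \<in> faces X \<Longrightarrow> x \<preceq>\<^bsub>X\<^esub> y \<Longrightarrow> fdim X x \<le> fdim X y"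
  using graded by (auto simp: graded_poset_def)

text \<open>Induction on the number of faces strictly between \<open>x\<close> and \<open>z\<close>:
  if \<open>z\<close> does not cover \<open>x\<close>, a face \<open>u\<close> between them can
  replace \<open>z\<close>, and the faces strictly below \<open>u\<close> no longer include
  \<open>u\<close>.\<close>

lemma exists_cover:
  assumes "x \<in> faces X" "z \<in> faces X" "x \<prec>\<^bsub>X\<^esub> z"
  shows "\<exists>c\<in>faces X. covered_by X x c \<and> c \<preceq>\<^bsub>X\<^esub> z"
  using assms
proof (induction "card {u \<in> faces X. x \<prec>\<^bsub>X\<^esub> u \<and> u \<prec>\<^bsub>X\<^esub> z}" arbitrary: z rule: less_induct)
  case less
  show ?case
  proof (cases "covered_by X x z")
    case True
    then show ?thesis using less.prems face_le_refl by blast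
  next
    case False
    then obtain u where u: "u \<in> faces X" "x \<prec>\<^bsub>X\<^esub> u" "u \<prec>\<^bsub>X\<^esub> z"
      using less.prems by (auto simp: covered_by_def)
    have "{v \<in> faces X. x \<prec>\<^bsub>X\<^esub> v \<and> v \<prec>\<^bsub>X\<^esub> u} \<subset> {v \<in> faces X. x \<prec>\<^bsub>X\<^esub> v \<and> v \<prec>\<^bsub>X\<^esub> z}"
      using u face_le_trans face_le_antisym by blast
    then have "card {v \<in> faces X. x \<prec>\<^bsub>X\<^esub> v \<and> v \<prec>\<^bsub>X\<^esub> u} < card {v \<in> faces X. x \<prec>\<^bsub>X\<^esub> v \<and> v \<prec>\<^bsub>X\<^esub> z}"
      by (intro psubset_card_mono) auto
    then show ?thesis
      using less.hyps[of u] less.prems u face_le_trans by blast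
  qed
qed

lemma fdim_cover:
  "x \<in> faces X \<Longrightarrow> y \<in> faces X \<Longrightarrow> covered_by X x y \<Longrightarrow> fdim X y = fdim X x + 1"
  using graded by (auto simp: graded_poset_def)

text \<open>A strict inequality would pass through a cover of \<open>x\<close>, whose dimension
  already exceeds that of \<open>y\<close>.\<close>

lemma face_eq_if_fdim_eq:
  assumes "x \<in> faces X" "y \<in> faces X" "x \<preceq>\<^bsub>X\<^esub> y" "fdim X x = fdim X y"
  shows "x = y"
proof (rule ccontr)
  assume "x \<noteq> y"
  then obtain c where "c \<in> faces X" "covered_by X x c" "c \<preceq>\<^bsub>X\<^esub> y"
    using exists_cover assms by blast
  then show False using fdim_cover fdim_mono assms by fastforce
qed

text \<open>Climbing from \<open>x\<close> towards \<open>z\<close> through covers raises the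
  dimension by exactly one each time, so no value \<open>j\<close> is skipped.\<close>

lemma exists_intermediate_face:
  assumes "x \<in> faces X" "z \<in> faces X" "x \<preceq>\<^bsub>X\<^esub> z" "fdim X x \<le> j" "j \<le> fdim X z"
  shows "\<exists>y\<in>ifaces X j. x \<preceq>\<^bsub>X\<^esub> y \<and> y \<preceq>\<^bsub>X\<^esub> z"
  using assms
proof (induction "nat (j - fdim X x)" arbitrary: x)
  case 0
  then show ?case using face_le_refl by (intro bexI[of _ x]) (auto simp: ifaces_def)
next
  case (Suc n)
  \<comment> \<open>The induction measure is positive, so \<open>x\<close> has dimension below
    \<open>j\<close> and \<open>z\<close> does not.\<close>
  then have "x \<noteq> z" by auto
  then obtain c where c: "c \<in> faces X" "covered_by X x c" "c \<preceq>\<^bsub>X\<^esub> z"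
    using exists_cover Suc.prems by blast
  then have "fdim X c = fdim X x + 1" using fdim_cover Suc.prems by blast
  then have "\<exists>y\<in>ifaces X j. c \<preceq>\<^bsub>X\<^esub> y \<and> y \<preceq>\<^bsub>X\<^esub> z"
    using Suc c by (intro Suc.hyps(1)) auto
  then show ?case using c face_le_trans unfolding covered_by_def by blast
qed

section \<open>Counting the faces in an interval\<close>

abbreviation interval :: "'a \<Rightarrow> int \<Rightarrow> 'a \<Rightarrow> 'a set"
  where "interval x j z \<equiv> {y \<in> ifaces X j. x \<preceq>\<^bsub>X\<^esub> y \<and> y \<preceq>\<^bsub>X\<^esub> z}"

text \<open>\<open>Max\<close> and \<open>Min\<close> bound the members of finite sets only, so the
  estimates by \<open>F_max\<close> and \<open>F_min\<close> rest on this.\<close>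

lemma finite_interval_counts: "finite (interval_counts X i j k)"
proof -
  have "interval_counts X i j k \<subseteq> (\<lambda>(x, z). card (interval x j z)) ` (ifaces X i \<times> ifaces X k)"
    by (auto simp: interval_counts_def)
  then show ?thesis by (rule finite_subset) auto
qed

lemma
  assumes "x \<in> ifaces X i" "z \<in> ifaces X k" "x \<preceq>\<^bsub>X\<^esub> z"
  shows F_min_le: "F_min X i j k \<le> card (interval x j z)"
    and le_F_max: "card (interval x j z) \<le> F_max X i j k"
proof -
  have "card (interval x j z) \<in> interval_counts X i j k"
    using assms by (auto simp: interval_counts_def)
  then show "F_min X i j k \<le> card (interval x j z)" "card (interval x j z) \<le> F_max X i j k"
    using finite_interval_counts by (auto simp: F_min_def F_max_def)
qed

lemma card_interval_pos:
  assumes "x \<in> ifaces X i" "z \<in> ifaces X k" "x \<preceq>\<^bsub>X\<^esub> z" "i \<le> j" "j \<le> k"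
  shows "0 < card (interval x j z)"
  using exists_intermediate_face[of x z j] assms by (auto simp: card_gt_0_iff ifaces_def)

text \<open>The minimum is attained, by an interval that contains a face of dimension
  \<open>j\<close>. Positivity keeps the quotients in the irregularity clear of division by
  zero.\<close>

lemma F_min_pos:
  assumes "x \<in> ifaces X i" "z \<in> ifaces X k" "x \<preceq>\<^bsub>X\<^esub> z" "i \<le> j" "j \<le> k"
  shows "0 < F_min X i j k"
proof -
  have "interval_counts X i j k \<noteq> {}"
    using assms by (auto simp: interval_counts_def)
  then have "F_min X i j k \<in> interval_counts X i j k"
    using finite_interval_counts by (simp add: F_min_def)
  then show ?thesis
    using card_interval_pos assms(4,5) by (fastforce simp: interval_counts_def)
qed

end

section \<open>Weights of faces and of faces of links\<close>

locale weighted_d_poset =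
  fixes d :: nat and X :: "'a gposet" and w :: "'a \<Rightarrow> real"
  assumes d_pos: "1 \<le> d"
    and d_poset: "d_poset d X"
    and proper_weight: "proper_weight d X w"
begin

sublocale finite_graded_poset X
  using d_poset by unfold_locales (simp add: d_poset_def)

text \<open>\<open>d_poset\<close> asserts only that such a face exists; antisymmetry makes it
  unique, so \<open>SOME\<close> names the empty face.\<close>

definition bottom :: 'a
  where "bottom = (SOME e. e \<in> faces X \<and> fdim X e = -1 \<and> (\<forall>x\<in>faces X. e \<preceq>\<^bsub>X\<^esub> x))"

lemma
  shows bottom_iface: "bottom \<in> ifaces X (-1)"
    and bottom_le: "x \<in> faces X \<Longrightarrow> bottom \<preceq>\<^bsub>X\<^esub> x"
proof -
  have "bottom \<in> faces X \<and> fdim X bottom = -1 \<and> (\<forall>x\<in>faces X. bottom \<preceq>\<^bsub>X\<^esub> x)"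
    unfolding bottom_def
    by (rule someI_ex) (use d_poset in \<open>unfold d_poset_def, blast\<close>)
  then show "bottom \<in> ifaces X (-1)" "x \<in> faces X \<Longrightarrow> bottom \<preceq>\<^bsub>X\<^esub> x"
    by (auto simp: ifaces_def)
qed

lemma exists_facet_above:
  assumes "x \<in> faces X"
  obtains y where "y \<in> ifaces X (int d)" "x \<preceq>\<^bsub>X\<^esub> y"
  using assms d_poset unfolding d_poset_def by blast

lemma weight_pos: "x \<in> faces X \<Longrightarrow> 0 < w x"
  using proper_weight by (simp add: proper_weight_def)

text \<open>Makes the set of counts nonempty for every admissible triple of dimensions:
  \<open>x\<close> and \<open>z\<close> are taken on one chain from the bottom to a facet.\<close>

lemma exists_faces_between:
  assumes "-1 \<le> i" "i \<le> k" "k \<le> int d"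
  shows "\<exists>x\<in>ifaces X i. \<exists>z\<in>ifaces X k. x \<preceq>\<^bsub>X\<^esub> z"
proof -
  obtain y where y: "y \<in> ifaces X (int d)" "bottom \<preceq>\<^bsub>X\<^esub> y"
    using exists_facet_above bottom_iface by (auto simp: ifaces_def)
  obtain x where x: "x \<in> ifaces X i" "x \<preceq>\<^bsub>X\<^esub> y"
    using exists_intermediate_face[of bottom y i] bottom_iface y assms
    by (auto simp: ifaces_def)
  obtain z where "z \<in> ifaces X k" "x \<preceq>\<^bsub>X\<^esub> z"
    using exists_intermediate_face[of x y k] x y assms by (auto simp: ifaces_def)
  then show ?thesis using x by blast
qed

lemma F_min_positive:
  assumes "-1 \<le> i" "i \<le> j" "j \<le> k" "k \<le> int d"
  shows "0 < F_min X i j k"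
  using exists_faces_between[of i k] F_min_pos assms by fastforce

text \<open>The form in which irregularity enters the estimates: replacing a maximal count by the
  minimal one costs one factor \<open>L\<close>.\<close>

lemma F_max_le_irregularity:
  assumes "-1 \<le> i" "i \<le> j" "j \<le> k" "k \<le> int d" "lower_irregularity d X \<le> L"
  shows "real (F_max X i j k) \<le> L * real (F_min X i j k)"
proof -
  let ?q = "\<lambda>i j k. real (F_max X i j k) / real (F_min X i j k)"
  let ?S = "{?q i j k | i j k. -1 \<le> i \<and> i \<le> j \<and> j \<le> k \<and> k \<le> int d}"
  \<comment> \<open>Only finitely many triples of dimensions are in range, which gives the
    finiteness required by \<open>Max_ge\<close>.\<close>
  have "?S \<subseteq> (\<lambda>(i, j, k). ?q i j k) ` ({-1..int d} \<times> {-1..int d} \<times> {-1..int d})"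
    by force
  then have "finite ?S" by (rule finite_subset) auto
  moreover have "?q i j k \<in> ?S" using assms by blast
  ultimately have "?q i j k \<le> lower_irregularity d X"
    unfolding lower_irregularity_def by (rule Max_ge)
  then have "?q i j k \<le> L" using assms by simp
  then show ?thesis
    using F_min_positive assms by (simp add: divide_le_eq)
qed

section \<open>Face weights against facet weights\<close>

lemma ifaces_of_eq_interval: "ifaces_of X y i = interval bottom i y"
  using bottom_le by (auto simp: ifaces_of_def ifaces_def)

text \<open>This is \<open>w(X(d)_x)\<close>, the normalising factor of the link weight.\<close>

definition top_weight :: "'a \<Rightarrow> real"
  where "top_weight x = (\<Sum>y\<in>above_face X (ifaces X (int d)) x. w y)"

lemma finite_above [simp, intro]: "finite (above_face X (ifaces X i) x)"
  by (simp add: above_face_def)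

lemma above_facet: "y \<in> above_face X (ifaces X (int d)) x \<longleftrightarrow> y \<in> ifaces X (int d) \<and> x \<preceq>\<^bsub>X\<^esub> y"
  by (auto simp: above_face_def)

lemma weight_pos_above: "y \<in> above_face X (ifaces X (int d)) x \<Longrightarrow> 0 < w y"
  by (simp add: above_face_def ifaces_def weight_pos)

lemma top_weight_pos:
  assumes "x \<in> faces X"
  shows "0 < top_weight x"
proof -
  obtain y where "y \<in> above_face X (ifaces X (int d)) x"
    using exists_facet_above assms by (auto simp: above_facet)
  then show ?thesis
    unfolding top_weight_def by (intro sum_pos) (auto intro: weight_pos_above)
qed

lemma weight_eq:
  assumes "x \<in> ifaces X i"
  shows "w x = (\<Sum>y\<in>above_face X (ifaces X (int d)) x. w y / real (card (interval bottom i y)))"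
  using proper_weight assms unfolding proper_weight_def by (simp add: ifaces_of_eq_interval)

text \<open>In the defining sum of a proper weight, each denominator counts the
  \<open>i\<close>-faces of one facet and so lies between \<open>F_min\<close> and
  \<open>F_max\<close>; what remains is the total weight of the facets above
  \<open>x\<close>.\<close>

lemma
  assumes "x \<in> ifaces X i" "-1 \<le> i" "i \<le> int d"
  shows weight_le: "w x \<le> top_weight x / F_min X (-1) i d"
    and weight_ge: "top_weight x / F_max X (-1) i d \<le> w x"
proof -
  have *: "w y / F_max X (-1) i d \<le> w y / real (card (interval bottom i y))"
    "w y / real (card (interval bottom i y)) \<le> w y / F_min X (-1) i d"
    if "y \<in> above_face X (ifaces X (int d)) x" for y
  proof -
    have y: "y \<in> ifaces X d" "bottom \<preceq>\<^bsub>X\<^esub> y"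
      using that bottom_le by (auto simp: above_face_def ifaces_def)
    have "0 < F_min X (-1) i d" using F_min_positive assms by simp
    then show "w y / F_max X (-1) i d \<le> w y / real (card (interval bottom i y))"
      "w y / real (card (interval bottom i y)) \<le> w y / F_min X (-1) i d"
      using le_F_max[OF bottom_iface y, of i] F_min_le[OF bottom_iface y, of i]
        weight_pos_above[OF that] card_interval_pos[OF bottom_iface y assms(2,3)]
      by (auto intro!: divide_left_mono simp del: card_gt_0_iff)
  qed
  show "w x \<le> top_weight x / F_min X (-1) i d"
    unfolding weight_eq[OF assms(1)] top_weight_def sum_divide_distrib
    by (intro sum_mono *)
  show "top_weight x / F_max X (-1) i d \<le> w x"
    unfolding weight_eq[OF assms(1)] top_weight_def sum_divide_distrib
    by (intro sum_mono *)
qed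

text \<open>The same comparison in the link of \<open>v\<close>, where denominators count faces
  between \<open>v\<close> and a facet. The factor \<open>top_weight v\<close> later cancels against
  the one in \<open>weight_le\<close>.\<close>

lemma link_weight_le:
  assumes "v \<in> ifaces X i" "x \<in> ifaces X j" "v \<preceq>\<^bsub>X\<^esub> x" "-1 \<le> i" "i \<le> j" "j \<le> int d"
  shows "link_weight d X w v x \<le> top_weight x / (top_weight v * F_min X i j d)"
proof -
  have "(\<Sum>y\<in>above_face X (ifaces X (int d)) x. w y / real (card (interval v j y)))
    \<le> (\<Sum>y\<in>above_face X (ifaces X (int d)) x. w y / F_min X i j d)"
  proof (rule sum_mono)
    fix y assume y: "y \<in> above_face X (ifaces X (int d)) x"
    then have "y \<in> ifaces X d" "v \<preceq>\<^bsub>X\<^esub> y"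
      using assms(3) face_le_trans by (auto simp: above_facet)
    then show "w y / real (card (interval v j y)) \<le> w y / F_min X i j d"
      using F_min_le[OF assms(1), of y d j] F_min_positive[OF assms(4-6)] weight_pos_above[OF y]
        card_interval_pos[OF assms(1), of y d j] assms(5,6)
      by (intro divide_left_mono) (auto simp del: card_gt_0_iff)
  qed
  also have "\<dots> = top_weight x / F_min X i j d"
    by (simp add: top_weight_def sum_divide_distrib)
  finally have *: "(\<Sum>y\<in>above_face X (ifaces X (int d)) x. w y / real (card (interval v j y)))
    \<le> top_weight x / F_min X i j d" .
  have "0 < top_weight v" using top_weight_pos assms(1) by (simp add: ifaces_def)
  moreover have "link_weight d X w v x =
    (\<Sum>y\<in>above_face X (ifaces X (int d)) x. w y / real (card (interval v j y))) / top_weight v"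
    using assms(2) by (simp add: link_weight_def top_weight_def ifaces_def)
  ultimately show ?thesis
    using divide_right_mono[OF *, of "top_weight v"] by (simp add: mult.commute)
qed

lemma link_weight_nonneg: "0 \<le> link_weight d X w v x"
  unfolding link_weight_def
  by (intro mult_nonneg_nonneg sum_nonneg divide_nonneg_nonneg)
    (auto simp: weight_pos_above less_imp_le)

text \<open>A face between \<open>v\<close> and a facet with the dimension of \<open>v\<close> can
  only be \<open>v\<close>, so all denominators are 1. By this normalisation, a nonzero cochain of
  degree -1 on the link has norm 1.\<close>

lemma link_weight_self:
  assumes "v \<in> faces X"
  shows "link_weight d X w v v = 1"
proof -
  have "{x \<in> ifaces X (fdim X v). v \<preceq>\<^bsub>X\<^esub> x \<and> x \<preceq>\<^bsub>X\<^esub> y} = {v}"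
    if "y \<in> above_face X (ifaces X (int d)) v" for y
    using that assms face_eq_if_fdim_eq[OF assms] face_le_refl
    by (auto simp: above_face_def ifaces_def) (metis)
  then show ?thesis
    using top_weight_pos[OF assms] by (simp add: link_weight_def top_weight_def)
qed

text \<open>Double counting of the pairs \<open>v \<preceq> e\<close> below a fixed facet.\<close>

lemma interval_count_product_le:
  assumes irr: "lower_irregularity d X \<le> L" and L: "1 \<le> L"
  shows "real (F_max X (-1) 1 d) * real (F_max X (-1) 0 1)
    \<le> L ^ 4 * (real (F_min X (-1) 0 d) * real (F_min X 0 1 d))"
proof -
  obtain y where y: "y \<in> ifaces X (int d)"
    using exists_faces_between[of "int d" "int d"] by auto
  then have by_y: "bottom \<preceq>\<^bsub>X\<^esub> y" using bottom_le by (simp add: ifaces_def)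
  let ?V = "interval bottom 0 y" and ?E = "interval bottom 1 y"
  have swap: "(\<Sum>e\<in>?E. card (interval bottom 0 e)) = (\<Sum>v\<in>?V. card (interval v 1 y))"
  proof -
    have "(\<Sum>e\<in>?E. card (interval bottom 0 e)) = (\<Sum>e\<in>?E. card {v \<in> ?V. v \<preceq>\<^bsub>X\<^esub> e})"
      by (intro sum.cong arg_cong[of _ _ card]) (auto intro: face_le_trans)
    also have "\<dots> = (\<Sum>v\<in>?V. card {e \<in> ?E. v \<preceq>\<^bsub>X\<^esub> e})"
      by (rule sum_multicount_gen) auto
    also have "\<dots> = (\<Sum>v\<in>?V. card (interval v 1 y))"
      by (intro sum.cong arg_cong[of _ _ card]) (auto intro: face_le_trans)
    finally show ?thesis .
  qed
  have "F_min X (-1) 1 d * F_min X (-1) 0 1 \<le> card ?E * F_min X (-1) 0 1"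
    using F_min_le[OF bottom_iface y by_y] by simp
  also have "\<dots> \<le> (\<Sum>e\<in>?E. card (interval bottom 0 e))"
    using sum_bounded_below[of ?E "F_min X (-1) 0 1"] F_min_le[OF bottom_iface] by auto
  also have "\<dots> \<le> card ?V * F_max X 0 1 d"
    unfolding swap using sum_bounded_above[of ?V _ "F_max X 0 1 d"] le_F_max y by auto
  also have "\<dots> \<le> F_max X (-1) 0 d * F_max X 0 1 d"
    using le_F_max[OF bottom_iface y by_y] by simp
  finally have count: "real (F_min X (-1) 1 d) * real (F_min X (-1) 0 1)
    \<le> real (F_max X (-1) 0 d) * real (F_max X 0 1 d)"
    unfolding of_nat_mult[symmetric] of_nat_le_iff .
  \<comment> \<open>Each maximum turned into a minimum costs one factor \<open>L\<close>: two before
    \<open>count\<close> is applied and two after it, whence \<open>L ^ 4\<close>.\<close>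
  note reg = F_max_le_irregularity[OF _ _ _ _ irr]
  have "real (F_max X (-1) 1 d) * real (F_max X (-1) 0 1)
    \<le> (L * F_min X (-1) 1 d) * (L * F_min X (-1) 0 1)"
    using d_pos L by (intro mult_mono reg) auto
  also have "\<dots> = L\<^sup>2 * (real (F_min X (-1) 1 d) * real (F_min X (-1) 0 1))"
    by (simp add: power2_eq_square)
  also have "\<dots> \<le> L\<^sup>2 * (real (F_max X (-1) 0 d) * real (F_max X 0 1 d))"
    using count by (rule mult_left_mono) simp
  also have "\<dots> \<le> L\<^sup>2 * ((L * F_min X (-1) 0 d) * (L * F_min X 0 1 d))"
    using d_pos L by (intro mult_left_mono mult_mono reg) auto
  also have "\<dots> = L ^ 4 * (real (F_min X (-1) 0 d) * real (F_min X 0 1 d))"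
    by (simp add: power2_eq_square power4_eq_xxxx)
  finally show ?thesis .
qed

text \<open>\<open>top_weight v\<close> is a factor of the bound for \<open>w v\<close> and a
  divisor of the bound for the link weight, so it cancels; \<open>weight_ge\<close> then turns
  \<open>top_weight e\<close> into \<open>w e\<close>.\<close>

lemma weight_mult_link_weight_le:
  assumes v: "v \<in> ifaces X 0" and e: "e \<in> ifaces X 1" and ve: "v \<preceq>\<^bsub>X\<^esub> e"
  shows "w v * link_weight d X w v e
    \<le> F_max X (-1) 1 d / (real (F_min X (-1) 0 d) * real (F_min X 0 1 d)) * w e"
proof -
  let ?a = "real (F_min X (-1) 0 d)" and ?b = "real (F_min X 0 1 d)" and ?c = "real (F_max X (-1) 1 d)"
  have pos: "0 < ?a" "0 < ?b" "0 < top_weight v" "0 < top_weight e" "0 < w v"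
    using F_min_positive d_pos v e top_weight_pos weight_pos by (auto simp: ifaces_def)
  \<comment> \<open>Any facet shows that \<open>F_max X (-1) 1 d\<close> is positive, so the
    denominator in \<open>weight_ge\<close> can be cleared.\<close>
  obtain y where "y \<in> ifaces X d" "bottom \<preceq>\<^bsub>X\<^esub> y"
    using exists_facet_above[of bottom] bottom_iface by (auto simp: ifaces_def)
  from card_interval_pos[OF bottom_iface this, of 1] le_F_max[OF bottom_iface this, of 1]
  have c: "0 < ?c" using d_pos by linarith
  have "w v * link_weight d X w v e \<le> (top_weight v / ?a) * (top_weight e / (top_weight v * ?b))"
    using pos weight_le[OF v] link_weight_le[OF v e ve] link_weight_nonneg d_pos
    by (intro mult_mono) auto
  also have "\<dots> = top_weight e / (?a * ?b)"
    using pos by (simp add: field_simps)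
  also have "\<dots> \<le> (?c * w e) / (?a * ?b)"
    using weight_ge[OF e] d_pos c pos by (intro divide_right_mono) (auto simp: field_simps)
  finally show ?thesis by simp
qed

text \<open>After exchanging the sums, an edge of \<open>B\<close> occurs once for each of its
  vertices in \<open>A\<close>, hence at most \<open>F_max X (-1) 0 1\<close> times. This number
  times the constant of \<open>weight_mult_link_weight_le\<close> is at most \<open>L ^ 4\<close> by
  \<open>interval_count_product_le\<close>.\<close>

lemma link_weights_le_edge_weights:
  assumes "lower_irregularity d X \<le> L" "1 \<le> L" "A \<subseteq> ifaces X 0" "B \<subseteq> ifaces X 1"
  shows "(\<Sum>v\<in>A. w v * (\<Sum>e | e \<in> B \<and> v \<preceq>\<^bsub>X\<^esub> e. link_weight d X w v e)) \<le> L ^ 4 * (\<Sum>e\<in>B. w e)"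
proof -
  let ?D = "real (F_min X (-1) 0 d) * real (F_min X 0 1 d)"
  let ?K = "F_max X (-1) 1 d / ?D"
  have fin: "finite A" "finite B" using assms finite_subset by blast+
  have "(\<Sum>v\<in>A. w v * (\<Sum>e | e \<in> B \<and> v \<preceq>\<^bsub>X\<^esub> e. link_weight d X w v e))
    \<le> (\<Sum>v\<in>A. \<Sum>e | e \<in> B \<and> v \<preceq>\<^bsub>X\<^esub> e. ?K * w e)"
    unfolding sum_distrib_left
    by (intro sum_mono weight_mult_link_weight_le) (use assms in auto)
  also have "\<dots> = (\<Sum>e\<in>B. \<Sum>v | v \<in> A \<and> v \<preceq>\<^bsub>X\<^esub> e. ?K * w e)"
    by (rule sum.swap_restrict) (use fin in auto)
  also have "\<dots> \<le> (\<Sum>e\<in>B. L ^ 4 * w e)"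
  proof (rule sum_mono)
    fix e assume "e \<in> B"
    then have e: "e \<in> ifaces X 1" using assms by blast
    then have we: "0 < w e" and be: "bottom \<preceq>\<^bsub>X\<^esub> e"
      by (auto simp: ifaces_def weight_pos bottom_le)
    have "card {v \<in> A. v \<preceq>\<^bsub>X\<^esub> e} \<le> card (interval bottom 0 e)"
      by (rule card_mono) (use assms bottom_le in \<open>auto simp: ifaces_def\<close>)
    also have "\<dots> \<le> F_max X (-1) 0 1"
      by (rule le_F_max[OF bottom_iface e be])
    finally have "card {v \<in> A. v \<preceq>\<^bsub>X\<^esub> e} \<le> F_max X (-1) 0 1" .
    then have "real (card {v \<in> A. v \<preceq>\<^bsub>X\<^esub> e}) * ?K \<le> F_max X (-1) 0 1 * ?K"
      by (intro mult_right_mono) auto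
    also have "\<dots> \<le> L ^ 4"
      using interval_count_product_le[OF assms(1,2)] F_min_positive[of "-1" 0 d] F_min_positive[of 0 1 d] d_pos
      by (simp add: divide_le_eq mult.commute)
    finally have "real (card {v \<in> A. v \<preceq>\<^bsub>X\<^esub> e}) * ?K * w e \<le> L ^ 4 * w e"
      using we by (intro mult_right_mono) auto
    then show "(\<Sum>v | v \<in> A \<and> v \<preceq>\<^bsub>X\<^esub> e. ?K * w e) \<le> L ^ 4 * w e"
      by (simp add: mult.assoc)
  qed
  finally show ?thesis by (simp add: sum_distrib_left)
qed

end

section \<open>Cocycles and expansion in vertex links\<close>

locale sheaf_weighted_d_poset = weighted_d_poset d X w
  for d :: nat and X :: "'a gposet" and w :: "'a \<Rightarrow> real" +
  fixes R :: "('r, 'b) ring_scheme"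
    and orn :: "'a \<Rightarrow> 'a \<Rightarrow> 'r" and S :: "('a, 'r, 'm) sheaf_data"
  assumes orientation: "orientation R X orn"
    and sheaf: "sheaf_on R X S"
begin

lemma module_stalk: "x \<in> faces X \<Longrightarrow> Module.module R (stalk S x)"
  using sheaf by (simp add: sheaf_on_def)

lemma abelian_group_stalk: "x \<in> faces X \<Longrightarrow> abelian_group (stalk S x)"
  using module_stalk by (auto simp: Module.module_def)

text \<open>The orientation is known to give units only at covers, so incidences in a coboundary
  must be recognised as such. A cover of \<open>x\<close> below \<open>y\<close> has the dimension
  of \<open>y\<close> and hence equals it.\<close>

lemma covered_by_if_fdim_Suc:
  assumes "x \<in> ifaces X i" "y \<in> ifaces X (i + 1)" "x \<preceq>\<^bsub>X\<^esub> y"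
  shows "covered_by X x y"
proof -
  have "x \<noteq> y" using assms by (auto simp: ifaces_def)
  then obtain c where c: "c \<in> faces X" "covered_by X x c" "c \<preceq>\<^bsub>X\<^esub> y"
    using exists_cover[of x y] assms by (auto simp: ifaces_def)
  then have "c = y"
    using fdim_cover[of x c] face_eq_if_fdim_eq[of c y] assms by (auto simp: ifaces_def)
  then show ?thesis using c by simp
qed

context
  fixes x y i
  assumes x: "x \<in> ifaces X i" and y: "y \<in> ifaces X (i + 1)" and xy: "x \<preceq>\<^bsub>X\<^esub> y"
begin

text \<open>The side condition under which a \<open>finsum\<close> of such terms can be
  rewritten.\<close>

lemma coboundary_term_closed:
  assumes "m \<in> carrier (stalk S x)"
  shows "orn y x \<odot>\<^bsub>stalk S y\<^esub> res_map S y x m \<in> carrier (stalk S y)"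
proof -
  have faces: "x \<in> faces X" "y \<in> faces X" "x \<noteq> y" using x y by (auto simp: ifaces_def)
  interpret My: Module.module R "stalk S y" using module_stalk faces by blast
  have "orn y x \<in> carrier R"
    using orientation faces covered_by_if_fdim_Suc[OF x y xy]
    by (auto simp: orientation_def Units_def)
  moreover have "res_map S y x \<in> linear_maps R (stalk S x) (stalk S y)"
    using sheaf faces xy by (auto simp: sheaf_on_def)
  ultimately show ?thesis
    using assms by (auto simp: linear_maps_def hom_def)
qed

text \<open>Faces where a cochain vanishes contribute nothing to its coboundary, since restriction
  and scalar multiplication preserve zero.\<close>

lemma coboundary_term_zero:
  "orn y x \<odot>\<^bsub>stalk S y\<^esub> res_map S y x \<zero>\<^bsub>stalk S x\<^esub> = \<zero>\<^bsub>stalk S y\<^esub>"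
proof -
  have faces: "x \<in> faces X" "y \<in> faces X" "x \<noteq> y" using x y by (auto simp: ifaces_def)
  interpret My: Module.module R "stalk S y" using module_stalk faces by blast
  interpret Mx: Module.module R "stalk S x" using module_stalk faces by blast
  have "orn y x \<in> carrier R"
    using orientation faces covered_by_if_fdim_Suc[OF x y xy]
    by (auto simp: orientation_def Units_def)
  moreover have "res_map S y x \<in> linear_maps R (stalk S x) (stalk S y)"
    using sheaf faces xy by (auto simp: sheaf_on_def)
  then have h: "res_map S y x \<in> hom (add_monoid (stalk S x)) (add_monoid (stalk S y))"
    by (simp add: linear_maps_def)
  have "res_map S y x \<zero>\<^bsub>stalk S x\<^esub> = \<zero>\<^bsub>stalk S y\<^esub>"
    using hom_one[OF h Mx.a_group My.a_group] by simp
  ultimately show ?thesis by simp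
qed

end

text \<open>Such an \<open>f\<close> is the coboundary of the zero cochain one degree lower.
  Contrapositively, a cochain that is not a coboundary has nonempty support.\<close>

lemma vanishing_mem_coboundaries:
  assumes f: "f \<in> cochains i X S" and zero: "\<And>x. x \<in> ifaces X i \<Longrightarrow> f x = \<zero>\<^bsub>stalk S x\<^esub>"
  shows "f \<in> coboundaries i X orn S"
proof -
  let ?g = "\<lambda>x\<in>ifaces X (i - 1). \<zero>\<^bsub>stalk S x\<^esub>"
  have "?g \<in> cochains (i - 1) X S"
    using abelian_group_stalk
    by (auto simp: cochains_def ifaces_def intro!: abelian_monoid.zero_closed abelian_group.axioms(1))
  moreover have "coboundary (i - 1) X orn S ?g = f"
  proof
    fix y
    show "coboundary (i - 1) X orn S ?g y = f y"
    proof (cases "y \<in> ifaces X i")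
      case True
      interpret My: abelian_group "stalk S y" using abelian_group_stalk True by (simp add: ifaces_def)
      have "finsum (stalk S y) (\<lambda>x. orn y x \<odot>\<^bsub>stalk S y\<^esub> res_map S y x (?g x)) (ifaces_of X y (i - 1))
        = finsum (stalk S y) (\<lambda>x. \<zero>\<^bsub>stalk S y\<^esub>) (ifaces_of X y (i - 1))"
        by (rule My.finsum_cong')
          (use True coboundary_term_zero[of _ "i - 1" y] in \<open>auto simp: ifaces_of_def\<close>)
      then show ?thesis using True zero by (simp add: coboundary_def)
    next
      case False
      \<comment> \<open>Both functions are extensional, so they are \<open>undefined\<close>
        here.\<close>
      then show ?thesis using f by (auto simp: coboundary_def cochains_def PiE_def extensional_def)
    qed
  qed
  ultimately show ?thesis unfolding coboundaries_def by blast
qed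

text \<open>Otherwise all other terms of the cocycle sum at \<open>e\<close> vanish and leave the
  nonzero term at \<open>v\<close>.\<close>

lemma cocycle_exists_other_vertex:
  assumes f: "f \<in> cocycles 0 X orn S" and e: "e \<in> ifaces X 1"
    and v: "v \<in> ifaces X 0" "v \<preceq>\<^bsub>X\<^esub> e"
    and nz: "orn e v \<odot>\<^bsub>stalk S e\<^esub> res_map S e v (f v) \<noteq> \<zero>\<^bsub>stalk S e\<^esub>"
  shows "\<exists>u\<in>ifaces_of X e 0. u \<noteq> v \<and> f u \<noteq> \<zero>\<^bsub>stalk S u\<^esub>"
proof (rule ccontr)
  assume *: "\<not> ?thesis"
  interpret Me: abelian_group "stalk S e" using abelian_group_stalk e by (simp add: ifaces_def)
  let ?t = "\<lambda>u. orn e u \<odot>\<^bsub>stalk S e\<^esub> res_map S e u (f u)"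
  have closed: "?t u \<in> carrier (stalk S e)" if "u \<in> ifaces_of X e 0" for u
    using f that e
    by (intro coboundary_term_closed[of u 0]) (auto simp: cocycles_def cochains_def ifaces_of_def)
  have "finsum (stalk S e) ?t (ifaces_of X e 0) =
    finsum (stalk S e) (\<lambda>u. if v = u then ?t u else \<zero>\<^bsub>stalk S e\<^esub>) (ifaces_of X e 0)"
    by (rule Me.finsum_cong')
      (use * closed e coboundary_term_zero[of _ 0 e] in \<open>auto simp: ifaces_of_def\<close>)
  also have "\<dots> = ?t v"
    by (rule Me.finsum_singleton) (use closed v in \<open>auto simp: ifaces_of_def\<close>)
  finally show False
    using f e nz by (auto simp: cocycles_def coboundary_def)
qed

section \<open>Links and their expansion in degree -1\<close>

lemma link_ifaces:
  "ifaces (link X v) i = {x \<in> ifaces X (i + fdim X v + 1). v \<preceq>\<^bsub>X\<^esub> x}"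
  by (auto simp: link_def ifaces_def above_face_def)

text \<open>The shift of dimensions puts \<open>v\<close> itself in degree -1, and every other face
  above \<open>v\<close> has larger dimension.\<close>

lemma link_ifaces_bottom:
  assumes "v \<in> faces X"
  shows "ifaces (link X v) (-1) = {v}"
  unfolding link_ifaces using assms face_eq_if_fdim_eq[OF assms] face_le_refl
  by (auto simp: ifaces_def) (metis)

text \<open>One test cochain suffices: the value \<open>m\<close> at the face \<open>v\<close> of
  the link. Its distance to the coboundaries is 1, so every admissible \<mu> is at most the norm of
  its coboundary, the sum on the right.\<close>

lemma cbe_link_le:
  assumes v: "v \<in> ifaces X i" and m: "m \<in> carrier (stalk S v)" "m \<noteq> \<zero>\<^bsub>stalk S v\<^esub>"
  shows "cbe (-1) (link X v) (link_weight d X w v) orn S \<le>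
    ereal (\<Sum>e | e \<in> ifaces X (i + 1) \<and> v \<preceq>\<^bsub>X\<^esub> e
        \<and> orn e v \<odot>\<^bsub>stalk S e\<^esub> res_map S e v m \<noteq> \<zero>\<^bsub>stalk S e\<^esub>. link_weight d X w v e)"
    (is "_ \<le> ereal ?n")
proof -
  let ?Y = "link X v" and ?u = "link_weight d X w v"
  have vf: "v \<in> faces X" and dim: "fdim X v = i" using v by (auto simp: ifaces_def)
  interpret Mv: abelian_group "stalk S v" using abelian_group_stalk vf .
  let ?f = "\<lambda>x\<in>{v}. m"
  have f: "?f \<in> cochains (-1) ?Y S"
    using m by (simp add: cochains_def link_ifaces_bottom[OF vf])
  \<comment> \<open>Degree -2 in the link is dimension \<open>i - 1\<close> in \<open>X\<close>, too
    small for a face above \<open>v\<close>.\<close>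
  have no_faces: "ifaces ?Y (-2) = {}"
    unfolding link_ifaces using fdim_mono[OF vf] by (force simp: ifaces_def)
  \<comment> \<open>The product over no faces is one point, and its coboundary at \<open>v\<close>
    is an empty sum; zero is thus the only coboundary.\<close>
  then have B: "coboundaries (-1) ?Y orn S = {\<lambda>x\<in>{v}. \<zero>\<^bsub>stalk S v\<^esub>}"
    by (auto simp: coboundaries_def coboundary_def cochains_def ifaces_of_def
        link_ifaces_bottom[OF vf] fun_eq_iff restrict_def)
  have minus_zero: "m \<ominus>\<^bsub>stalk S v\<^esub> \<zero>\<^bsub>stalk S v\<^esub> = m"
    using m Mv.add.inv_one by (simp add: a_minus_def a_inv_def)
  have dist: "(INF g\<in>coboundaries (-1) ?Y orn S. wdist (-1) ?Y ?u S ?f g) = 1"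
  proof -
    \<comment> \<open>The support of the difference between \<open>?f\<close> and zero, with the
      restrictions unfolded.\<close>
    have "{x. x = v \<and> (if x = v then m \<ominus>\<^bsub>stalk S v\<^esub> \<zero>\<^bsub>stalk S v\<^esub> else undefined) \<noteq> \<zero>\<^bsub>stalk S x\<^esub>} = {v}"
      using m by (auto simp: minus_zero)
    then show ?thesis
      using m link_weight_self[OF vf]
      by (simp add: B wdist_def wnorm_def link_ifaces_bottom[OF vf] restrict_def cong: conj_cong)
  qed
  have edge: "ifaces_of ?Y e (-1) = {v}" if "e \<in> ifaces ?Y 0" for e
    using that vf face_le_refl
    by (auto simp: ifaces_of_def link_ifaces_bottom[OF vf])
      (auto simp: link_def ifaces_def above_face_def)
  have edges: "e \<in> ifaces ?Y 0 \<longleftrightarrow> e \<in> ifaces X (i + 1) \<and> v \<preceq>\<^bsub>X\<^esub> e" for e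
    by (simp add: link_ifaces dim)
  have cob: "coboundary (-1) ?Y orn S ?f e = orn e v \<odot>\<^bsub>stalk S e\<^esub> res_map S e v m"
    if "e \<in> ifaces ?Y 0" for e
  proof -
    have e: "e \<in> ifaces X (i + 1)" "v \<preceq>\<^bsub>X\<^esub> e" "e \<in> faces X"
      using that unfolding edges by (auto simp: ifaces_def)
    interpret Me: abelian_group "stalk S e" using abelian_group_stalk e by blast
    show ?thesis
      using that coboundary_term_closed[OF v e(1,2) m(1)] by (simp add: coboundary_def edge)
  qed
  have norm: "wnorm 0 ?Y ?u S (coboundary (-1) ?Y orn S ?f) = ?n"
    unfolding wnorm_def
    using cob by (intro sum.cong Collect_cong) (auto simp: edges)
  show ?thesis
    unfolding cbe_def
  proof (rule Sup_least, clarify)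
    fix \<mu> :: real
    assume "\<forall>f\<in>cochains (-1) ?Y S. \<mu> * (INF g\<in>coboundaries (-1) ?Y orn S. wdist (-1) ?Y ?u S f g)
      \<le> wnorm (-1 + 1) ?Y ?u S (coboundary (-1) ?Y orn S f)"
    from bspec[OF this f] show "ereal \<mu> \<le> ereal ?n" by (simp add: dist norm)
  qed
qed

section \<open>Lower bound for the norm of nontrivial cocycles\<close>

lemma ccd_0_ge:
  assumes irr: "lower_irregularity d X \<le> L" and L: "1 \<le> L"
    and link: "\<And>v. v \<in> ifaces X 0 \<Longrightarrow>
      ereal \<epsilon> \<le> cbe (-1) (link X v) (link_weight d X w v) orn S"
    and skel: "skeleton_expander (Gr X w) \<alpha> \<beta>" and \<beta>: "0 < \<beta>"
  shows "ereal ((\<epsilon> / L ^ 4 - \<alpha>) / \<beta>) \<le> ccd 0 X w orn S"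
  unfolding ccd_def
proof (rule INF_greatest)
  fix f assume "f \<in> cocycles 0 X orn S - coboundaries 0 X orn S"
  then have f: "f \<in> cocycles 0 X orn S" and nB: "f \<notin> coboundaries 0 X orn S" by auto
  have fc: "f \<in> cochains 0 X S" using f by (simp add: cocycles_def)
  define A where "A = {v \<in> ifaces X 0. f v \<noteq> \<zero>\<^bsub>stalk S v\<^esub>}"
  define B where "B = {e \<in> ifaces X 1. \<exists>u v. u \<noteq> v \<and> {u, v} \<subseteq> ifaces_of X e 0 \<inter> A}"
  have sub: "A \<subseteq> ifaces X 0" "B \<subseteq> ifaces X 1" by (auto simp: A_def B_def)
  then have fin: "finite A" "finite B" using finite_subset by blast+
  \<comment> \<open>\<open>W\<close> is the norm of \<open>f\<close>, the quantity to be bounded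
    from below.\<close>
  define W where "W = (\<Sum>v\<in>A. w v)"
  have "A \<noteq> {}" using nB vanishing_mem_coboundaries[OF fc] by (auto simp: A_def)
  then have W: "0 < W"
    unfolding W_def using fin sub by (intro sum_pos) (auto simp: ifaces_def weight_pos)
  have "\<epsilon> \<le> (\<Sum>e | e \<in> B \<and> v \<preceq>\<^bsub>X\<^esub> e. link_weight d X w v e)" if v: "v \<in> A" for v
  proof -
    have v0: "v \<in> ifaces X 0" and fv: "f v \<noteq> \<zero>\<^bsub>stalk S v\<^esub>" using v by (auto simp: A_def)
    have "f v \<in> carrier (stalk S v)" using fc v0 by (auto simp: cochains_def)
    from order_trans[OF link[OF v0] cbe_link_le[OF v0 this fv]]
    have "\<epsilon> \<le> (\<Sum>e | e \<in> ifaces X 1 \<and> v \<preceq>\<^bsub>X\<^esub> e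
        \<and> orn e v \<odot>\<^bsub>stalk S e\<^esub> res_map S e v (f v) \<noteq> \<zero>\<^bsub>stalk S e\<^esub>. link_weight d X w v e)"
      by simp
    also have "\<dots> \<le> (\<Sum>e | e \<in> B \<and> v \<preceq>\<^bsub>X\<^esub> e. link_weight d X w v e)"
    proof (rule sum_mono2)
      show "finite {e \<in> B. v \<preceq>\<^bsub>X\<^esub> e}" using fin by simp
      show "{e \<in> ifaces X 1. v \<preceq>\<^bsub>X\<^esub> e \<and> orn e v \<odot>\<^bsub>stalk S e\<^esub> res_map S e v (f v) \<noteq> \<zero>\<^bsub>stalk S e\<^esub>}
        \<subseteq> {e \<in> B. v \<preceq>\<^bsub>X\<^esub> e}"
        (is "?N \<subseteq> _")
      proof
        fix e assume "e \<in> ?N"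
        then have e: "e \<in> ifaces X 1" "v \<preceq>\<^bsub>X\<^esub> e"
          and "orn e v \<odot>\<^bsub>stalk S e\<^esub> res_map S e v (f v) \<noteq> \<zero>\<^bsub>stalk S e\<^esub>"
          by auto
        then obtain u where "u \<in> ifaces_of X e 0" "u \<noteq> v" "f u \<noteq> \<zero>\<^bsub>stalk S u\<^esub>"
          using cocycle_exists_other_vertex[OF f e(1) v0 e(2)] by blast
        then show "e \<in> {e \<in> B. v \<preceq>\<^bsub>X\<^esub> e}"
          using e v v0 by (auto simp: B_def A_def ifaces_of_def)
      qed
      show "0 \<le> link_weight d X w v e" for e
        by (rule link_weight_nonneg)
    qed
    finally show ?thesis .
  qed
  then have "(\<Sum>v\<in>A. w v * \<epsilon>)
    \<le> (\<Sum>v\<in>A. w v * (\<Sum>e | e \<in> B \<and> v \<preceq>\<^bsub>X\<^esub> e. link_weight d X w v e))"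
    using sub weight_pos by (intro sum_mono mult_left_mono) (auto simp: ifaces_def less_imp_le)
  also have "\<dots> \<le> L ^ 4 * (\<Sum>e\<in>B. w e)"
    by (rule link_weights_le_edge_weights[OF irr L sub])
  also have "(\<Sum>e\<in>B. w e) \<le> \<alpha> * W + \<beta> * W\<^sup>2"
    using skel sub(1) by (simp add: skeleton_expander_def Gr_def B_def W_def)
  then have "L ^ 4 * (\<Sum>e\<in>B. w e) \<le> L ^ 4 * (\<alpha> * W + \<beta> * W\<^sup>2)"
    using L by (intro mult_left_mono) auto
  finally have "\<epsilon> * W \<le> (L ^ 4 * (\<alpha> + \<beta> * W)) * W"
    unfolding sum_distrib_right[symmetric] W_def[symmetric]
    by (simp add: algebra_simps power2_eq_square)
  \<comment> \<open>Cancelling \<open>W\<close> leaves one factor \<open>W\<close> of the quadratic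
    term, and this factor carries the bound.\<close>
  then have "\<epsilon> \<le> L ^ 4 * (\<alpha> + \<beta> * W)" using W by simp
  then have "\<epsilon> / L ^ 4 \<le> \<alpha> + \<beta> * W" using L by (simp add: divide_le_eq mult.commute)
  then have "(\<epsilon> / L ^ 4 - \<alpha>) / \<beta> \<le> W" using \<beta> by (simp add: divide_le_eq algebra_simps)
  then show "ereal ((\<epsilon> / L ^ 4 - \<alpha>) / \<beta>) \<le> ereal (wnorm 0 X w S f)"
    by (simp add: W_def A_def wnorm_def)
qed

text \<open>If the bracket is positive, \<open>L \<ge> 1\<close> makes this weaker than
  \<open>ccd_0_ge\<close>. Otherwise the factor \<open>1 / L ^ 3\<close> would work in the wrong
  direction, but then the left side is at most zero and norms are nonnegative.\<close>

lemma ccd_0_ge_weak: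
  assumes irr: "lower_irregularity d X \<le> L" and L: "1 \<le> L" and \<epsilon>: "0 \<le> \<epsilon>"
    and link: "\<And>v. v \<in> ifaces X 0 \<Longrightarrow>
      ereal \<epsilon> \<le> cbe (-1) (link X v) (link_weight d X w v) orn S"
    and skel: "skeleton_expander (Gr X w) \<alpha> \<beta>" and \<beta>: "0 < \<beta>"
  shows "ereal (1 / L ^ 3 * (1 / L ^ 8 * \<epsilon> - \<alpha>) / \<beta>) \<le> ccd 0 X w orn S"
proof (cases "1 / L ^ 8 * \<epsilon> - \<alpha> \<le> 0")
  case True
  then have "1 / L ^ 3 * (1 / L ^ 8 * \<epsilon> - \<alpha>) / \<beta> \<le> 0"
    using L \<beta> by (intro divide_nonpos_pos mult_nonneg_nonpos) auto
  moreover have "0 \<le> ereal (wnorm 0 X w S f)" for f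
    unfolding wnorm_def
    by (auto intro!: sum_nonneg simp: ifaces_def weight_pos less_imp_le)
  \<comment> \<open>This includes the case without nontrivial cocycles, in which \<open>ccd\<close>
    is infinite.\<close>
  then have "0 \<le> ccd 0 X w orn S"
    unfolding ccd_def by (intro INF_greatest)
  ultimately show ?thesis
    by (metis ereal_less_eq(3) order_trans zero_ereal_def)
next
  case False
  have "1 / L ^ 8 * \<epsilon> \<le> \<epsilon> / L ^ 4"
    using L \<epsilon> power_increasing[of 4 8 L] by (simp add: divide_left_mono)
  moreover have "1 / L ^ 3 * (1 / L ^ 8 * \<epsilon> - \<alpha>) \<le> 1 * (1 / L ^ 8 * \<epsilon> - \<alpha>)"
    using False L by (intro mult_right_mono) auto
  ultimately have "1 / L ^ 3 * (1 / L ^ 8 * \<epsilon> - \<alpha>) / \<beta> \<le> (\<epsilon> / L ^ 4 - \<alpha>) / \<beta>"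
    using \<beta> by (intro divide_right_mono) auto
  then show ?thesis
    using ccd_0_ge[OF irr L link skel \<beta>] by (metis ereal_less_eq(3) order_trans)
qed

end

theorem theorem8p13:
  fixes F :: nat and L :: real
  assumes "1 \<le> L"
  shows "let
      setting = (\<lambda>(R :: ('r, 'b) ring_scheme) (d :: nat) (X :: 'a gposet) w orn
                  (S :: ('a, 'r, 'm) sheaf_data) (\<epsilon> :: real) (\<alpha> :: real) (\<beta> :: real).
        cring R \<and> 1 \<le> d \<and> d_poset d X \<and> proper_weight d X w \<and> orientation R X orn \<and>
        lower_irregularity d X \<le> L \<and>
        (\<forall>e\<in>ifaces X 1. card (ifaces_of X e 0) \<le> F) \<and>
        sheaf_on R X S \<and>
        0 \<le> \<epsilon> \<and> 0 \<le> \<alpha> \<and> 0 \<le> \<beta> \<and>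
        (\<forall>v\<in>ifaces X 0. ereal \<epsilon> \<le> cbe (-1) (link X v) (link_weight d X w v) orn S) \<and>
        skeleton_expander (Gr X w) \<alpha> \<beta>);
      bound = (\<lambda>(E :: real) (E''' :: real) X w orn S \<epsilon> \<alpha> \<beta>.
        0 < \<beta> \<longrightarrow> ereal (E''' * (E * \<epsilon> - \<alpha>) / \<beta>) \<le> ccd 0 X w orn S)
    in
      (\<exists>E>0. \<exists>E'''>0. \<forall>R d X w orn S \<epsilon> \<alpha> \<beta>.
        setting R d X w orn S \<epsilon> \<alpha> \<beta> \<longrightarrow> bound E E''' X w orn S \<epsilon> \<alpha> \<beta>) \<and>
      (\<forall>R d X w orn S \<epsilon> \<alpha> \<beta>.
        setting R d X w orn S \<epsilon> \<alpha> \<beta> \<longrightarrow> bound (1 / L ^ 8) (1 / L ^ 3) X w orn S \<epsilon> \<alpha> \<beta>) \<and>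
      (\<forall>R d X w orn S \<epsilon> \<alpha> \<beta>.
        setting R d X w orn S \<epsilon> \<alpha> \<beta> \<and> lower_regular d X \<longrightarrow> bound 1 1 X w orn S \<epsilon> \<alpha> \<beta>)"
proof -
  \<comment> \<open>\<open>L'\<close> is kept apart from \<open>L\<close> so that the lower-regular
    case can take it to be 1, where both constants become 1.\<close>
  have bound: "ereal (1 / L' ^ 3 * (1 / L' ^ 8 * \<epsilon> - \<alpha>) / \<beta>) \<le> ccd 0 X w orn S"
    if "1 \<le> d" "d_poset d X" "proper_weight d X w" "orientation R X orn"
      "1 \<le> L'" "lower_irregularity d X \<le> L'" "sheaf_on R X S" "0 \<le> \<epsilon>"
      "\<forall>v\<in>ifaces X 0. ereal \<epsilon> \<le> cbe (-1) (link X v) (link_weight d X w v) orn S"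
      "skeleton_expander (Gr X w) \<alpha> \<beta>" "0 < \<beta>"
    for R :: "('r, 'b) ring_scheme" and d and X :: "'a gposet" and w orn
      and S :: "('a, 'r, 'm) sheaf_data" and \<epsilon> \<alpha> \<beta> L' :: real
  proof -
    interpret sheaf_weighted_d_poset d X w R orn S
      using that by unfold_locales
    show ?thesis by (rule ccd_0_ge_weak) (use that in auto)
  qed
  have pos: "0 < 1 / L ^ 8" "0 < 1 / L ^ 3" using assms by auto
  show ?thesis
    unfolding Let_def lower_regular_def
    apply (intro conjI)
      apply (rule exI[of _ "1 / L ^ 8"], rule conjI[OF pos(1)])
      apply (rule exI[of _ "1 / L ^ 3"], rule conjI[OF pos(2)])
      apply (intro allI impI, elim conjE, rule bound[OF _ _ _ _ assms]; assumption)
     apply (intro allI impI, elim conjE, rule bound[OF _ _ _ _ assms]; assumption)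
    apply (intro allI impI, elim conjE, rule bound[where L' = 1, simplified power_one div_by_1]; (assumption | simp))
    done
qed

end
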